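(* Let $p$ be an odd prime and let $G$ be a powerful $p$-group. Then for all integers $i,j\geq 1$ the subgroup $\Omega_i(G^{p^j})$ is powerfully nilpotent, and its powerful nilpotency class is at most $i$.
   Context: For a group $X$ and an integer $n\ge 1$, $X^{n}$ denotes the subgroup of $X$ generated by all $n$th powers of elements of $X$. For a finite $p$-group $X$, $\Omega_i(X)$ is the subgroup generated by all elements of $X$ whose order divides $p^i$. $X'$ denotes the commutator subgroup of $X$. A finite $p$-group $X$ is powerful if $p>2$ and $X'\leq X^{p}$, or $p=2$ and $X'\leq X^{4}$. A powerful $p$-group $X$ is powerfully nilpotent if it has a chain of subgroups $\{1\}=H_0\leq H_1\leq\dots\leq H_n=X$ such that $[H_k,X]\leq H_{k-1}^{p}$ for $k=1,\dots,n$. Such a chain is called a powerfully central chain (of length $n$). The powerful nilpotency class of a powerfully nilpotent group $X$ is the shortest length that a powerfully central chain of $X$ can have. In particular, a powerfully nilpotent group is powerful. *)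

theory Defs
  imports "HOL-Algebra.Algebra" "HOL-Computational_Algebra.Primes"
begin

text \<open>
  Subgroups of a group \<open>G\<close> are represented by their carriers; a subgroup \<open>H\<close> is regarded as
  a group in its own right via \<open>G\<lparr>carrier := H\<rparr>\<close>.
\<close>

definition finite_p_group :: "nat \<Rightarrow> ('a, 'b) monoid_scheme \<Rightarrow> bool" where
  "finite_p_group p G \<longleftrightarrow>
     Factorial_Ring.prime p \<and> group G \<and> finite (carrier G) \<and> (\<exists>n. order G = p ^ n)"

definition power_subgroup :: "('a, 'b) monoid_scheme \<Rightarrow> nat \<Rightarrow> 'a set" where
  "power_subgroup G n = generate G ((\<lambda>x. x [^]\<^bsub>G\<^esub> n) ` carrier G)"

definition Omega :: "nat \<Rightarrow> nat \<Rightarrow> ('a, 'b) monoid_scheme \<Rightarrow> 'a set" where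
  "Omega p i G = generate G {x \<in> carrier G. group.ord G x dvd p ^ i}"

text \<open>
  The two-argument version of \<^const>\<open>derived\<close>, with the same commutator convention. The other
  convention \<open>[h, k] = h\<inverse>k\<inverse>hk\<close> generates the same subgroup when \<open>H\<close> and \<open>K\<close> are subgroups.
\<close>

definition commutator_subgroup ::
    "('a, 'b) monoid_scheme \<Rightarrow> 'a set \<Rightarrow> 'a set \<Rightarrow> 'a set" where
  "commutator_subgroup G H K =
     generate G {h \<otimes>\<^bsub>G\<^esub> k \<otimes>\<^bsub>G\<^esub> inv\<^bsub>G\<^esub> h \<otimes>\<^bsub>G\<^esub> inv\<^bsub>G\<^esub> k | h k. h \<in> H \<and> k \<in> K}"

definition powerful :: "nat \<Rightarrow> ('a, 'b) monoid_scheme \<Rightarrow> bool" where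
  "powerful p G \<longleftrightarrow> finite_p_group p G \<and>
     (p > 2 \<and> derived G (carrier G) \<subseteq> power_subgroup G p \<or>
      p = 2 \<and> derived G (carrier G) \<subseteq> power_subgroup G 4)"

text \<open>Only the values \<open>H 0, \<dots>, H n\<close> of \<open>H\<close> are relevant.\<close>

definition powerfully_central_chain ::
    "nat \<Rightarrow> ('a, 'b) monoid_scheme \<Rightarrow> nat \<Rightarrow> (nat \<Rightarrow> 'a set) \<Rightarrow> bool" where
  "powerfully_central_chain p G n H \<longleftrightarrow>
     (\<forall>k\<le>n. subgroup (H k) G) \<and>
     H 0 = {\<one>\<^bsub>G\<^esub>} \<and> H n = carrier G \<and>
     (\<forall>k\<in>{1..n}. H (k - 1) \<subseteq> H k) \<and>
     (\<forall>k\<in>{1..n}. commutator_subgroup G (H k) (carrier G)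
                    \<subseteq> power_subgroup (G\<lparr>carrier := H (k - 1)\<rparr>) p)"

definition powerfully_nilpotent :: "nat \<Rightarrow> ('a, 'b) monoid_scheme \<Rightarrow> bool" where
  "powerfully_nilpotent p G \<longleftrightarrow>
     powerful p G \<and> (\<exists>n H. powerfully_central_chain p G n H)"

text \<open>Meaningful only for powerfully nilpotent \<open>G\<close>; otherwise the value is unspecified.\<close>

definition powerful_class :: "nat \<Rightarrow> ('a, 'b) monoid_scheme \<Rightarrow> nat" where
  "powerful_class p G = (LEAST n. \<exists>H. powerfully_central_chain p G n H)"

end

theory Submission
  imports Defs
begin

text \<open>
  Write \<open>P k\<close> for \<open>G^(p^k)\<close>. The key fact is that commutation with elements of small order lowers
  orders: if \<open>x \<in> P c\<close>, \<open>x^(p^(b+1)) = 1\<close> and \<open>h^(p^(b+c)) = 1\<close>, then \<open>[x, h]^(p^b) = 1\<close>. It also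
  yields, by induction on the order of \<open>G\<close>, that the elements of order dividing \<open>p^a\<close> form a subgroup.
  Hence \<open>U c a = {x \<in> P c. x^(p^a) = 1}\<close> is a normal subgroup, and since every element of \<open>P (c + 1)\<close>
  is a \<open>p\<close>-th power of an element of \<open>P c\<close>, every element of \<open>U (c + 1) a\<close> is a \<open>p\<close>-th power of an
  element of \<open>U c (a + 1)\<close>. Writing the elements of \<open>U j i\<close> as \<open>p\<close>-th powers and using the key fact
  twice gives \<open>[U (j + i - k) (k + 1), U j i] \<subseteq> U (j + i - k + 2) (k - 1)\<close>, so that the subgroups
  \<open>U (j + i - k) (k + 1)\<close> with \<open>0 < k < i\<close> between \<open>1\<close> and \<open>U j i\<close> form a powerfully central chain.
\<close>

section \<open>Commutators and powers\<close>

definition commutator :: "('a, 'b) monoid_scheme \<Rightarrow> 'a \<Rightarrow> 'a \<Rightarrow> 'a" where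
  "commutator G x y = x \<otimes>\<^bsub>G\<^esub> y \<otimes>\<^bsub>G\<^esub> inv\<^bsub>G\<^esub> x \<otimes>\<^bsub>G\<^esub> inv\<^bsub>G\<^esub> y"

context group
begin

lemma commutator_closed [simp, intro]:
  "\<lbrakk>x \<in> carrier G; y \<in> carrier G\<rbrakk> \<Longrightarrow> commutator G x y \<in> carrier G"
  by (simp add: commutator_def)

lemma inv_mult_cancel:
  "\<lbrakk>x \<in> carrier G; y \<in> carrier G\<rbrakk> \<Longrightarrow> inv x \<otimes> (x \<otimes> y) = y"
  "\<lbrakk>x \<in> carrier G; y \<in> carrier G\<rbrakk> \<Longrightarrow> x \<otimes> (inv x \<otimes> y) = y"
  by (simp_all flip: m_assoc)

lemma commutator_mult:
  "\<lbrakk>x \<in> carrier G; y \<in> carrier G\<rbrakk> \<Longrightarrow> commutator G x y \<otimes> (y \<otimes> x) = x \<otimes> y"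
  by (simp add: commutator_def m_assoc inv_mult_cancel)

lemma commutator_eq_one_iff:
  "\<lbrakk>x \<in> carrier G; y \<in> carrier G\<rbrakk> \<Longrightarrow> commutator G x y = \<one> \<longleftrightarrow> x \<otimes> y = y \<otimes> x"
  using commutator_mult[of x y] r_cancel_one'[of "y \<otimes> x" "commutator G x y"] by auto

lemma inv_commutator:
  "\<lbrakk>x \<in> carrier G; y \<in> carrier G\<rbrakk> \<Longrightarrow> inv (commutator G x y) = commutator G y x"
  unfolding commutator_def by (simp add: inv_mult_group m_assoc)

lemma conj_eq_commutator_mult:
  "\<lbrakk>x \<in> carrier G; y \<in> carrier G\<rbrakk> \<Longrightarrow> x \<otimes> y \<otimes> inv x = commutator G x y \<otimes> y"
  unfolding commutator_def by (simp add: m_assoc)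

lemma pow_conj:
  "\<lbrakk>g \<in> carrier G; x \<in> carrier G\<rbrakk> \<Longrightarrow> (g \<otimes> x \<otimes> inv g) [^] (n::nat) = g \<otimes> x [^] n \<otimes> inv g"
proof (induction n)
  case (Suc n)
  then show ?case
    by (simp add: m_assoc inv_mult_cancel)
qed simp

lemma subgroup_nat_pow_closed:
  "\<lbrakk>subgroup H G; x \<in> H\<rbrakk> \<Longrightarrow> x [^] (n::nat) \<in> H"
  by (induction n) (simp_all add: subgroup.one_closed subgroup.m_closed)

lemma inv_comm_commute:
  assumes "x \<in> carrier G" "y \<in> carrier G" "x \<otimes> y = y \<otimes> x"
  shows "inv x \<otimes> y = y \<otimes> inv x"
  using assms by (metis inv_closed inv_solve_left inv_solve_right m_assoc m_closed)

text \<open>Here \<open>d\<close> is [b, a], and it is central in the group generated by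
  \<open>a\<close> and \<open>b\<close>. Collecting the \<open>a\<close>'s on the left moves each of
  them past the \<open>b\<close>'s before it, at the cost of one \<open>d\<close> per
  crossing.\<close>

lemma pow_mult_class2:
  fixes n :: nat
  assumes a: "a \<in> carrier G" and b: "b \<in> carrier G" and d: "d \<in> carrier G"
    and ba: "b \<otimes> a = d \<otimes> (a \<otimes> b)" and da: "d \<otimes> a = a \<otimes> d" and db: "d \<otimes> b = b \<otimes> d"
  shows "(a \<otimes> b) [^] n = a [^] n \<otimes> b [^] n \<otimes> d [^] (n choose 2)"
proof (induction n)
  case 0
  show ?case by (simp add: numeral_2_eq_2)
next
  case (Suc n)
  have pow_ba: "b [^] k \<otimes> a = a \<otimes> b [^] k \<otimes> d [^] k" for k :: nat
  proof (induction k)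
    case (Suc k)
    have "b [^] Suc k \<otimes> a = b [^] k \<otimes> (a \<otimes> (b \<otimes> d))"
      using a b d by (simp add: m_assoc ba) (metis da db m_assoc)
    also have "\<dots> = a \<otimes> b [^] k \<otimes> (d [^] k \<otimes> b) \<otimes> d"
      using a b d Suc.IH by (simp flip: m_assoc)
    also have "d [^] k \<otimes> b = b \<otimes> d [^] k"
      using group_commutes_pow[OF db] b d by simp
    finally show ?case using a b d by (simp add: m_assoc)
  qed (use a in simp)
  let ?D = "d [^] (n choose 2)"
  have Da: "?D \<otimes> a = a \<otimes> ?D" and Db: "?D \<otimes> b = b \<otimes> ?D" "d [^] n \<otimes> b = b \<otimes> d [^] n"
    using group_commutes_pow[OF da] group_commutes_pow[OF db] a b d by auto
  have "(a \<otimes> b) [^] Suc n = a [^] n \<otimes> b [^] n \<otimes> ?D \<otimes> (a \<otimes> b)"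
    using Suc.IH by simp
  also have "\<dots> = a [^] n \<otimes> (b [^] n \<otimes> a) \<otimes> (b \<otimes> ?D)"
    using a b d by (simp add: m_assoc) (metis Da Db(1) m_assoc m_closed nat_pow_closed)
  also have "\<dots> = a [^] n \<otimes> a \<otimes> b [^] n \<otimes> (d [^] n \<otimes> b) \<otimes> ?D"
    using a b d by (simp add: pow_ba m_assoc)
  also have "\<dots> = a [^] Suc n \<otimes> b [^] Suc n \<otimes> (d [^] n \<otimes> ?D)"
    using a b d by (simp add: Db m_assoc)
  also have "d [^] n \<otimes> ?D = d [^] (Suc n choose 2)"
    using d by (simp add: nat_pow_mult numeral_2_eq_2)
  finally show ?case .
qed

text \<open>An odd \<open>p\<close> divides \<open>p choose 2\<close>, so
  \<open>d [^] p = \<one>\<close> already kills the correction term of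
  \<open>pow_mult_class2\<close>.\<close>

lemma odd_pow_mult_class2:
  fixes p :: nat
  assumes p: "odd p" and a: "a \<in> carrier G" and b: "b \<in> carrier G" and d: "d \<in> carrier G"
    and ba: "b \<otimes> a = d \<otimes> (a \<otimes> b)" and da: "d \<otimes> a = a \<otimes> d" and db: "d \<otimes> b = b \<otimes> d"
    and dp: "d [^] p = \<one>"
  shows "(a \<otimes> b) [^] p = a [^] p \<otimes> b [^] p"
proof -
  have "p choose 2 = p * ((p - 1) div 2)"
    using p by (simp add: choose_two div_mult_swap)
  then have "d [^] (p choose 2) = \<one>"
    using d dp by (simp flip: nat_pow_pow)
  then show ?thesis using pow_mult_class2[OF a b d ba da db, of p] a b by simp
qed

text \<open>Conjugating \<open>u\<close> by \<open>h\<close> gives \<open>inv z \<otimes> u\<close>,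
  and \<open>u\<close> and \<open>z\<close> generate a group of class at most two in which p-th
  powers can be taken factor by factor. As \<open>z [^] p = \<one>\<close>, conjugation by
  \<open>h\<close> fixes \<open>u [^] p\<close>.\<close>

lemma pow_commutes_class3:
  fixes p :: nat
  assumes p: "odd p" and u: "u \<in> carrier G" and h: "h \<in> carrier G"
    and z: "z = commutator G u h" and d: "d = commutator G z u"
    and du: "d \<otimes> u = u \<otimes> d" and dz: "d \<otimes> z = z \<otimes> d"
    and zp: "z [^] p = \<one>" and dp: "d [^] p = \<one>"
  shows "u [^] p \<otimes> h = h \<otimes> u [^] p"
proof -
  have zc: "z \<in> carrier G" and dc: "d \<in> carrier G" using u h z d by auto
  have "h \<otimes> u \<otimes> inv h = inv z \<otimes> u"
    using conj_eq_commutator_mult[OF h u] inv_commutator[OF u h] z by simp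
  \<comment> \<open>Thus [u, z^-1] is again \<open>d\<close>; the equation has the shape that
    \<open>odd_pow_mult_class2\<close> takes for \<open>a = inv z\<close> and
    \<open>b = u\<close>.\<close>
  moreover have "u \<otimes> inv z = d \<otimes> (inv z \<otimes> u)"
  proof -
    have "z \<otimes> u = d \<otimes> (u \<otimes> z)" using commutator_mult[OF zc u] d by simp
    then have "z \<otimes> u \<otimes> inv z = d \<otimes> u" using zc dc u by (simp add: m_assoc)
    then have "u \<otimes> inv z = inv z \<otimes> (d \<otimes> u)"
      using zc dc u by (metis inv_closed inv_solve_left m_assoc m_closed)
    then show ?thesis using dz zc dc u
      by (metis inv_closed inv_solve_left inv_solve_right m_assoc m_closed)
  qed
  moreover have "d \<otimes> inv z = inv z \<otimes> d" using dz zc dc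
    by (metis inv_closed inv_solve_left inv_solve_right m_assoc m_closed)
  ultimately have "(h \<otimes> u \<otimes> inv h) [^] p = (inv z) [^] p \<otimes> u [^] p"
    using odd_pow_mult_class2[OF p, of "inv z" u d] zc dc u du dp by simp
  then have "h \<otimes> u [^] p \<otimes> inv h = u [^] p"
    using pow_conj[OF h u] zc u zp by (simp add: nat_pow_inv)
  then show ?thesis using h u by (metis inv_solve_right m_closed nat_pow_closed)
qed

end

lemma (in group_hom) hom_commutator:
  "\<lbrakk>x \<in> carrier G; y \<in> carrier G\<rbrakk> \<Longrightarrow> h (commutator G x y) = commutator H (h x) (h y)"
  by (simp add: commutator_def)

section \<open>Commutator identities modulo a normal subgroup\<close>

context normal
begin

lemma quotient_group_hom: "group_hom G (G Mod H) (\<lambda>x. H #> x)"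
  by (simp add: group_hom_axioms_def group_hom_def factorgroup_is_group is_group r_coset_hom_Mod)

lemma quotient_eq_one_iff: "x \<in> carrier G \<Longrightarrow> H #> x = \<one>\<^bsub>G Mod H\<^esub> \<longleftrightarrow> x \<in> H"
  using coset_join1[OF _ _ is_subgroup] coset_join2[OF _ is_subgroup] by auto

lemma quotient_commutes_iff:
  assumes "x \<in> carrier G" "y \<in> carrier G"
  shows "(H #> x) \<otimes>\<^bsub>G Mod H\<^esub> (H #> y) = (H #> y) \<otimes>\<^bsub>G Mod H\<^esub> (H #> x) \<longleftrightarrow> commutator G x y \<in> H"
proof -
  interpret Q: group_hom G "G Mod H" "\<lambda>x. H #> x" by (rule quotient_group_hom)
  show ?thesis
    using assms Q.H.commutator_eq_one_iff quotient_eq_one_iff[of "commutator G x y"]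
    by (simp add: Q.hom_commutator)
qed

lemma commutator_swap_mem:
  "\<lbrakk>x \<in> carrier G; y \<in> carrier G\<rbrakk> \<Longrightarrow> commutator G x y \<in> H \<longleftrightarrow> commutator G y x \<in> H"
  by (simp flip: quotient_commutes_iff) (rule eq_commute)

lemma commutator_left_mem:
  assumes "x \<in> H" "y \<in> carrier G"
  shows "commutator G x y \<in> H"
proof -
  have "x \<otimes> (y \<otimes> inv x \<otimes> inv y) \<in> H"
    using assms inv_op_closed2 by simp
  then show ?thesis
    using assms mem_carrier by (simp add: commutator_def m_assoc)
qed

text \<open>This is the preimage of the centralizer of the image of \<open>A\<close> in the
  quotient. It reduces a commutator condition on a generated subgroup to its generators.\<close>

lemma centralizer_mod_subgroup:
  assumes "A \<subseteq> carrier G"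
  shows "subgroup {x \<in> carrier G. \<forall>a\<in>A. commutator G x a \<in> H} G"
proof -
  interpret Q: group_hom G "G Mod H" "\<lambda>x. H #> x" by (rule quotient_group_hom)
  let ?comm = "\<lambda>x a. (H #> x) \<otimes>\<^bsub>G Mod H\<^esub> (H #> a) = (H #> a) \<otimes>\<^bsub>G Mod H\<^esub> (H #> x)"
  have comm_iff: "commutator G x a \<in> H \<longleftrightarrow> ?comm x a" if "x \<in> carrier G" "a \<in> A" for x a
    using that assms quotient_commutes_iff[of x a] by blast
  have "?comm (inv x) a" if "x \<in> carrier G" "a \<in> A" "?comm x a" for x a
    using that assms Q.H.inv_comm_commute[of "H #> x" "H #> a"] Q.hom_closed by auto
  moreover have "?comm (x \<otimes> y) a"
    if "x \<in> carrier G" "y \<in> carrier G" "a \<in> A" "?comm x a" "?comm y a" for x y a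
  proof -
    have "a \<in> carrier G" using that assms by auto
    then show ?thesis using that Q.hom_mult Q.hom_closed Q.H.m_assoc by metis
  qed
  moreover have "commutator G \<one> a \<in> H" if "a \<in> A" for a
    using that assms by (intro commutator_left_mem) auto
  ultimately show ?thesis
    by (intro subgroupI) (auto simp: comm_iff intro!: exI[of _ \<one>])
qed

text \<open>\<open>pow_commutes_class3\<close> read in the quotient by \<open>H\<close>. It is the
  tool for all commutator estimates below: an element is written as a p-th power
  \<open>u [^] p\<close>, and its commutator with \<open>h\<close> is controlled through
  \<open>z\<close> and \<open>d\<close>.\<close>

lemma odd_pow_commutator_mem:
  fixes p :: nat
  assumes "odd p" "u \<in> carrier G" "h \<in> carrier G"
    and z: "z = commutator G u h" and d: "d = commutator G z u"
    and "commutator G d u \<in> H" "commutator G d z \<in> H"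
    and "z [^] p \<in> H" "d [^] p \<in> H"
  shows "commutator G (u [^] p) h \<in> H"
proof -
  interpret Q: group_hom G "G Mod H" "\<lambda>x. H #> x" by (rule quotient_group_hom)
  have [simp]: "z \<in> carrier G" "d \<in> carrier G" using assms by auto
  have "(H #> u) [^]\<^bsub>G Mod H\<^esub> p \<otimes>\<^bsub>G Mod H\<^esub> (H #> h) = (H #> h) \<otimes>\<^bsub>G Mod H\<^esub> (H #> u) [^]\<^bsub>G Mod H\<^esub> p"
  proof (rule Q.H.pow_commutes_class3[OF \<open>odd p\<close>, where z = "H #> z" and d = "H #> d"])
    show "(H #> z) [^]\<^bsub>G Mod H\<^esub> p = \<one>\<^bsub>G Mod H\<^esub>" "(H #> d) [^]\<^bsub>G Mod H\<^esub> p = \<one>\<^bsub>G Mod H\<^esub>"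
      using assms quotient_eq_one_iff by (simp_all flip: Q.hom_nat_pow)
  qed (use assms in \<open>auto simp only: quotient_commutes_iff Q.hom_commutator[symmetric] Q.hom_closed commutator_closed\<close>)
  then show ?thesis using assms quotient_commutes_iff[of "u [^] p" h] by (simp add: Q.hom_nat_pow)
qed

lemma odd_pow_mult_mod:
  fixes p :: nat
  assumes "odd p" "a \<in> carrier G" "b \<in> carrier G"
    and d: "d = commutator G b a"
    and "commutator G d a \<in> H" "commutator G d b \<in> H" "d [^] p \<in> H"
  shows "H #> (a \<otimes> b) [^] p = H #> (a [^] p \<otimes> b [^] p)"
proof -
  interpret Q: group_hom G "G Mod H" "\<lambda>x. H #> x" by (rule quotient_group_hom)
  have [simp]: "d \<in> carrier G" using assms by auto
  have "((H #> a) \<otimes>\<^bsub>G Mod H\<^esub> (H #> b)) [^]\<^bsub>G Mod H\<^esub> p =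
      (H #> a) [^]\<^bsub>G Mod H\<^esub> p \<otimes>\<^bsub>G Mod H\<^esub> (H #> b) [^]\<^bsub>G Mod H\<^esub> p"
  proof (rule Q.H.odd_pow_mult_class2[OF \<open>odd p\<close>, where d = "H #> d"])
    show "(H #> d) [^]\<^bsub>G Mod H\<^esub> p = \<one>\<^bsub>G Mod H\<^esub>"
      using assms quotient_eq_one_iff by (simp flip: Q.hom_nat_pow)
    show "(H #> b) \<otimes>\<^bsub>G Mod H\<^esub> (H #> a) = (H #> d) \<otimes>\<^bsub>G Mod H\<^esub> ((H #> a) \<otimes>\<^bsub>G Mod H\<^esub> (H #> b))"
      using assms commutator_mult[of b a] by (metis Q.hom_mult \<open>d \<in> carrier G\<close> m_closed)
  qed (use assms in \<open>auto simp only: quotient_commutes_iff Q.hom_closed commutator_closed\<close>)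
  then show ?thesis using assms by (simp only: Q.hom_mult Q.hom_nat_pow nat_pow_closed m_closed)
qed

text \<open>Modulo \<open>H\<close> the generators in \<open>A\<close> are central and only
  \<open>h\<close> remains, so the generated group is abelian. The fact \<open>gen\<close> passes
  from generators to the whole group; it is used first for commuting with \<open>h\<close>, then for
  commuting with \<open>y\<close>.\<close>

lemma commutator_mem_of_generate_insert:
  assumes h: "h \<in> carrier G" and A: "A \<subseteq> carrier G"
    and central: "\<And>a g. \<lbrakk>a \<in> A; g \<in> carrier G\<rbrakk> \<Longrightarrow> commutator G a g \<in> H"
    and x: "x \<in> generate G (insert h A)" and y: "y \<in> generate G (insert h A)"
  shows "commutator G x y \<in> H"
proof -
  have gen: "generate G (insert h A) \<subseteq> {z \<in> carrier G. \<forall>a\<in>{g}. commutator G z a \<in> H}"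
    if g: "g \<in> carrier G" and hg: "commutator G h g \<in> H" for g
    using that h A central by (intro generate_subgroup_incl centralizer_mod_subgroup) auto
  have "commutator G h h \<in> H"
    using h commutator_eq_one_iff[of h h] by simp
  then have "commutator G y h \<in> H" using gen[OF h] y by auto
  moreover have yc: "y \<in> carrier G" using y generate_in_carrier[of "insert h A"] h A by auto
  ultimately have "commutator G h y \<in> H" using commutator_swap_mem h by blast
  then show ?thesis using gen[OF yc] x by auto
qed

end

section \<open>Finite p-groups\<close>

lemma (in group) p_group_center_nontrivial:
  fixes p n :: nat
  assumes p: "Factorial_Ring.prime p" and ord: "order G = p ^ n" and nontriv: "carrier G \<noteq> {\<one>}"
  obtains z where "z \<in> carrier G" "z \<noteq> \<one>" "\<And>g. g \<in> carrier G \<Longrightarrow> g \<otimes> z = z \<otimes> g"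
proof -
  have fin: "finite (carrier G)"
    using ord p order_gt_0_iff_finite by (simp add: prime_gt_0_nat)
  let ?\<phi> = "\<lambda>g. \<lambda>h \<in> carrier G. g \<otimes> h \<otimes> inv g"
  interpret act: group_action G "carrier G" ?\<phi> by (rule action_by_conjugation)
  have "n \<noteq> 0" using ord nontriv order_one_triv_iff by auto
  then have p_dvd: "p dvd order G" using ord by simp
  have orbit: "orbit G ?\<phi> x = {g \<otimes> x \<otimes> inv g | g. g \<in> carrier G}" if "x \<in> carrier G" for x
    using that unfolding orbit_def by auto
  have one_orbit: "orbit G ?\<phi> \<one> = {\<one>}" by (auto simp: orbit intro!: exI[of _ "\<one>"])
  let ?O = "orbits G (carrier G) ?\<phi>"
  have finO: "finite ?O" using fin by (simp add: orbits_def)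
  have oneO: "{\<one>} \<in> ?O" unfolding orbits_def using one_orbit by (metis (mono_tags, lifting) mem_Collect_eq one_closed)
  have "(\<Sum>orb\<in>?O. card orb) = order G"
    using act.disjoint_sum[OF fin, of "\<lambda>_. 1::nat"] by (simp add: order_def)
  then have sum: "1 + (\<Sum>orb\<in>?O - {{\<one>}}. card orb) = order G"
    using sum.remove[OF finO oneO, of card] by simp
  \<comment> \<open>Orbit sizes are powers of \<open>p\<close>. Since {1} is an orbit and
    \<open>p\<close> divides the order, some other orbit has size prime to \<open>p\<close>, hence
    is a single point, which is a central element.\<close>
  have "\<exists>orb\<in>?O - {{\<one>}}. \<not> p dvd card orb"
  proof (rule ccontr)
    assume "\<not> ?thesis"
    then have "p dvd (\<Sum>orb\<in>?O - {{\<one>}}. card orb)" by (intro dvd_sum) auto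
    with p_dvd have "p dvd order G - (\<Sum>orb\<in>?O - {{\<one>}}. card orb)" by (rule dvd_diff_nat)
    moreover have "order G - (\<Sum>orb\<in>?O - {{\<one>}}. card orb) = 1" using sum by linarith
    ultimately have "p dvd 1" by (simp only:)
    with p show False by (simp add: prime_nat_iff)
  qed
  then obtain orb where "orb \<in> ?O" "orb \<noteq> {\<one>}" "\<not> p dvd card orb" by auto
  then obtain z where z: "z \<in> carrier G" "orbit G ?\<phi> z \<noteq> {\<one>}" "\<not> p dvd card (orbit G ?\<phi> z)"
    unfolding orbits_def by auto
  have "card (orbit G ?\<phi> z) dvd p ^ n"
    using dvd_triv_left[of "card (orbit G ?\<phi> z)" "card (stabilizer G ?\<phi> z)"]
    by (simp only: act.orbit_stabilizer_theorem[OF z(1)] ord)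
  then obtain k where "card (orbit G ?\<phi> z) = p ^ k"
    by (auto simp only: divides_primepow_nat[OF p])
  with z(3) have "card (orbit G ?\<phi> z) = 1" by (cases k) auto
  then obtain w where "orbit G ?\<phi> z = {w}" by (rule card_1_singletonE)
  with act.orbit_refl[OF z(1)] have single: "orbit G ?\<phi> z = {z}" by (simp only: singleton_iff)
  show ?thesis
  proof
    show "z \<in> carrier G" "z \<noteq> \<one>" using z single one_orbit by auto
    fix g assume g: "g \<in> carrier G"
    then have "g \<otimes> z \<otimes> inv g = z" using single orbit[OF z(1)] by blast
    then show "g \<otimes> z = z \<otimes> g" using g z(1) by (metis inv_solve_right m_closed)
  qed
qed

text \<open>In place of nilpotency: to prove \<open>A \<subseteq> N\<close> one may assume that \<open>A\<close> is central modulo a normal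
  subgroup containing \<open>N\<close>.\<close>

lemma (in group) p_group_normal_centralizing:
  fixes p n :: nat
  assumes p: "Factorial_Ring.prime p" and ord: "order G = p ^ n"
    and N: "N \<lhd> G" and A: "A \<subseteq> carrier G" "\<not> A \<subseteq> N"
  obtains M where "M \<lhd> G" "N \<subseteq> M" "\<not> A \<subseteq> M"
    "\<forall>a\<in>A. \<forall>g\<in>carrier G. commutator G a g \<in> M"
proof -
  have fin: "finite (carrier G)"
    using ord p order_gt_0_iff_finite by (simp add: prime_gt_0_nat)
  \<comment> \<open>Choose \<open>M\<close> maximal in \<open>?S\<close>. The preimage
    \<open>?Z\<close> of the centre of G/M is properly larger than \<open>M\<close>, so by
    maximality it contains \<open>A\<close>.\<close>
  let ?S = "{M. M \<lhd> G \<and> N \<subseteq> M \<and> \<not> A \<subseteq> M}"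
  have "?S \<subseteq> Pow (carrier G)" using normal_imp_subgroup subgroup.subset by blast
  then have "finite ?S" using fin finite_subset by blast
  moreover have "?S \<noteq> {}" using N A by auto
  ultimately have "\<exists>M\<in>?S. \<forall>K\<in>?S. M \<subseteq> K \<longrightarrow> M = K" by (rule finite_has_maximal)
  then obtain M where M: "M \<in> ?S" and max: "\<forall>K\<in>?S. M \<subseteq> K \<longrightarrow> M = K"
    by (rule bexE)
  interpret M: normal M G using M by simp
  interpret Q: group_hom G "G Mod M" "\<lambda>x. M #> x" by (rule M.quotient_group_hom)
  have "M \<noteq> carrier G" using M A by auto
  then have nontriv: "carrier (G Mod M) \<noteq> {\<one>\<^bsub>G Mod M\<^esub>}"
    using M.fact_group_trivial_iff[OF fin] by simp
  have "order (G Mod M) * card M = p ^ n"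
    using lagrange[OF M.is_subgroup] ord by (simp add: order_def FactGroup_def)
  then obtain k where k: "order (G Mod M) = p ^ k"
    using divides_primepow_nat[OF p, of "order (G Mod M)" n] dvd_triv_left by metis
  obtain q where q: "q \<in> carrier (G Mod M)" "q \<noteq> \<one>\<^bsub>G Mod M\<^esub>"
    "\<And>g. g \<in> carrier (G Mod M) \<Longrightarrow> g \<otimes>\<^bsub>G Mod M\<^esub> q = q \<otimes>\<^bsub>G Mod M\<^esub> g"
    using Q.H.p_group_center_nontrivial[OF p k nontriv] by metis
  then obtain x where x: "x \<in> carrier G" "q = M #> x"
    by (auto simp: FactGroup_def RCOSETS_def)
  let ?Z = "{x \<in> carrier G. \<forall>a\<in>carrier G. commutator G x a \<in> M}"
  have sub: "subgroup ?Z G" by (rule M.centralizer_mod_subgroup) simp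
  have MZ: "M \<subseteq> ?Z" using M.commutator_left_mem M.subset by auto
  have "?Z \<lhd> G"
  proof (rule normal_invI[OF sub])
    fix g y assume g: "g \<in> carrier G" and y: "y \<in> ?Z"
    then have "commutator G g y \<in> ?Z" using M.commutator_swap_mem MZ by blast
    then show "g \<otimes> y \<otimes> inv g \<in> ?Z"
      using g y conj_eq_commutator_mult[of g y] subgroup.m_closed[OF sub] by auto
  qed
  have x_in: "x \<in> ?Z" "x \<notin> M"
    using x q M.quotient_commutes_iff[of x] M.quotient_eq_one_iff[of x] Q.hom_closed by auto
  have "A \<subseteq> ?Z"
  proof (rule ccontr)
    assume "\<not> A \<subseteq> ?Z"
    then have "?Z \<in> ?S" using \<open>?Z \<lhd> G\<close> M MZ by blast
    then have "M = ?Z" using max MZ by blast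
    then show False using x_in by blast
  qed
  then show ?thesis using that[of M] M by blast
qed

section \<open>Power subgroups of powerful groups\<close>

text \<open>Iterating p-th powers makes induction along the chain direct. Agreement with G^(p^k)
  comes only in \<open>power_chain_eq_power_subgroup\<close>, because it rests on the extraction of
  p-th roots.\<close>

primrec power_chain :: "('a, 'b) monoid_scheme \<Rightarrow> nat \<Rightarrow> nat \<Rightarrow> 'a set" where
  "power_chain G p 0 = carrier G"
| "power_chain G p (Suc k) = generate G ((\<lambda>x. x [^]\<^bsub>G\<^esub> p) ` power_chain G p k)"

declare power_chain.simps(2) [simp del]

lemma (in group) normal_power_generate:
  fixes p :: nat
  assumes "N \<lhd> G"
  shows "generate G ((\<lambda>x. x [^] p) ` N) \<lhd> G"
proof -
  interpret normal N G by fact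
  have "g \<otimes> x [^] p \<otimes> inv g \<in> (\<lambda>x. x [^] p) ` N" if "x \<in> N" "g \<in> carrier G" for x g
    using that pow_conj[of g x p] inv_op_closed2 by (intro image_eqI[of _ _ "g \<otimes> x \<otimes> inv g"]) auto
  then show ?thesis by (intro normal_generateI) auto
qed

lemma (in group) power_subgroup_restrict:
  assumes "subgroup H G"
  shows "power_subgroup (G\<lparr>carrier := H\<rparr>) n = generate G ((\<lambda>x. x [^] n) ` H)"
  unfolding power_subgroup_def
  using generate_consistent[OF _ assms] subgroup_nat_pow_closed[OF assms]
  by (simp add: nat_pow_consistent[symmetric] image_subset_iff)

locale odd_powerful_group = group G for G (structure) +
  fixes p :: nat
  assumes prime: "Factorial_Ring.prime p" and odd: "odd p" and powerful: "powerful p G"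
begin

abbreviation "P k \<equiv> power_chain G p k"

lemma prime_gt_2: "p > 2"
  using prime odd prime_ge_2_nat[of p] by (cases "p = 2") auto

lemma finite_carrier: "finite (carrier G)"
  using powerful by (simp add: powerful_def finite_p_group_def)

lemma order_eq_power: obtains n where "order G = p ^ n"
  using powerful by (auto simp: powerful_def finite_p_group_def)

lemma exponent:
  obtains n where "\<And>x m. \<lbrakk>x \<in> carrier G; n \<le> m\<rbrakk> \<Longrightarrow> x [^] (p ^ m) = \<one>"
proof -
  obtain n where n: "order G = p ^ n" by (rule order_eq_power)
  have "x [^] (p ^ m) = \<one>" if x: "x \<in> carrier G" and "n \<le> m" for x m
  proof -
    have "p ^ m = p ^ n * p ^ (m - n)" using \<open>n \<le> m\<close> by (simp flip: power_add)
    then show ?thesis using x pow_order_eq_1[OF x] n by (simp flip: nat_pow_pow)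
  qed
  then show ?thesis by (rule that)
qed

lemma power_chain_normal: "P k \<lhd> G"
  by (induction k) (simp_all add: power_chain.simps(2) normal_power_generate normal_self)

lemmas power_chain_subgroup = normal_imp_subgroup[OF power_chain_normal]

lemma power_chain_carrier: "x \<in> P k \<Longrightarrow> x \<in> carrier G"
  using subgroup.mem_carrier[OF power_chain_subgroup] .

lemma pow_in_power_chain: "x \<in> P k \<Longrightarrow> x [^] p \<in> P (Suc k)"
  by (simp add: power_chain.simps(2) generate.incl)

lemma power_chain_Suc_subset: "P (Suc k) \<subseteq> P k"
proof -
  interpret normal "P k" G by (rule power_chain_normal)
  show ?thesis
    using generate_subgroup_incl[OF _ is_subgroup] subgroup_nat_pow_closed[OF is_subgroup]
    by (simp add: power_chain.simps(2) image_subset_iff)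
qed

lemma power_chain_antimono: "k \<le> l \<Longrightarrow> P l \<subseteq> P k"
  by (rule lift_Suc_antimono_le[of P]) (simp_all only: power_chain_Suc_subset)

text \<open>The case \<open>k = 0\<close> is powerfulness. Otherwise the commutators in question may
  be taken to be central modulo some \<open>M\<close> above \<open>P (Suc (Suc k))\<close>. For a
  generator \<open>u [^] p\<close> of \<open>P (Suc k)\<close>, the element [u, h] lies in
  \<open>P (Suc k)\<close> by induction, so [[u, h], u] is one of these commutators and is central
  modulo \<open>M\<close>, while both p-th powers lie in \<open>M\<close>. Hence [u^p, h] lies in
  \<open>M\<close>, against the choice of \<open>M\<close>.\<close>

lemma commutator_in_power_chain:
  "\<lbrakk>x \<in> P k; g \<in> carrier G\<rbrakk> \<Longrightarrow> commutator G x g \<in> P (Suc k)"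
proof (induction k arbitrary: x g)
  case 0
  have "derived G (carrier G) \<subseteq> P 1"
    using powerful prime_gt_2 by (auto simp: powerful_def power_subgroup_def power_chain.simps(2))
  moreover have "commutator G x g \<in> derived G (carrier G)"
    unfolding derived_def commutator_def using 0 by (intro generate.incl) auto
  ultimately show ?case by auto
next
  case (Suc k)
  let ?A = "{commutator G y g | y g. y \<in> P (Suc k) \<and> g \<in> carrier G}"
  obtain n where n: "order G = p ^ n" by (rule order_eq_power)
  have A: "?A \<subseteq> carrier G" using power_chain_carrier by blast
  have "?A \<subseteq> P (Suc (Suc k))"
  proof (rule ccontr)
    assume notsub: "\<not> ?A \<subseteq> P (Suc (Suc k))"
    obtain M where "M \<lhd> G" and sup: "P (Suc (Suc k)) \<subseteq> M" and notM: "\<not> ?A \<subseteq> M"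
      and cen: "\<forall>a\<in>?A. \<forall>g\<in>carrier G. commutator G a g \<in> M"
      by (rule p_group_normal_centralizing[OF prime n power_chain_normal A notsub])
    interpret M: normal M G by fact
    interpret N: normal "P (Suc k)" G by (rule power_chain_normal)
    have "commutator G (u [^] p) h \<in> M" if u: "u \<in> P k" and h: "h \<in> carrier G" for u h
    proof (rule M.odd_pow_commutator_mem[OF odd _ h refl refl])
      show uc: "u \<in> carrier G" using u power_chain_carrier by blast
      have z: "commutator G u h \<in> P (Suc k)" using Suc.IH[OF u h] .
      then have d: "commutator G (commutator G u h) u \<in> ?A" using uc by blast
      then show "commutator G (commutator G (commutator G u h) u) u \<in> M"
        "commutator G (commutator G (commutator G u h) u) (commutator G u h) \<in> M"
        using cen uc h by auto
      show "commutator G u h [^] p \<in> M" "commutator G (commutator G u h) u [^] p \<in> M"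
        using sup pow_in_power_chain N.commutator_left_mem[OF z uc] z by blast+
    qed
    then have "(\<lambda>x. x [^] p) ` P k \<subseteq> {x \<in> carrier G. \<forall>a\<in>carrier G. commutator G x a \<in> M}"
      using power_chain_carrier by auto
    then have "P (Suc k) \<subseteq> {x \<in> carrier G. \<forall>a\<in>carrier G. commutator G x a \<in> M}"
      using generate_subgroup_incl[OF _ M.centralizer_mod_subgroup[OF subset_refl]]
      by (simp add: power_chain.simps(2))
    then show False using notM by blast
  qed
  then show ?case using Suc.prems by blast
qed

text \<open>Otherwise \<open>P k\<close> is nontrivial and central modulo some \<open>M\<close>. Let
  p^(r+1) be its exponent there. The elements killed by p^r modulo \<open>M\<close> form a subgroup
  that contains all p-th powers, hence all of \<open>P (Suc k) = P k\<close>, a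
  contradiction.\<close>

lemma power_chain_stable_imp_trivial:
  assumes stable: "P (Suc k) = P k"
  shows "P k = {\<one>}"
proof (rule ccontr)
  assume "P k \<noteq> {\<one>}"
  then have notsub: "\<not> P k \<subseteq> {\<one>}"
    using subgroup.one_closed[OF power_chain_subgroup, of k] by blast
  obtain n where n: "order G = p ^ n" by (rule order_eq_power)
  obtain M where "M \<lhd> G" and "{\<one>} \<subseteq> M" and notM: "\<not> P k \<subseteq> M"
    and cen: "\<forall>a\<in>P k. \<forall>g\<in>carrier G. commutator G a g \<in> M"
    by (rule p_group_normal_centralizing[OF prime n one_is_normal _ notsub])
      (use power_chain_carrier in auto)
  interpret M: normal M G by fact
  interpret K: normal "P k" G by (rule power_chain_normal)
  interpret Q: group_hom G "G Mod M" "\<lambda>x. M #> x" by (rule M.quotient_group_hom)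
  obtain e where e: "\<And>x m. \<lbrakk>x \<in> carrier G; e \<le> m\<rbrakk> \<Longrightarrow> x [^] (p ^ m) = \<one>"
    by (rule exponent) blast
  define Q where "Q r \<longleftrightarrow> (\<forall>w\<in>P k. w [^] (p ^ r) \<in> M)" for r
  have "Q e" using e by (auto simp: Q_def)
  moreover have "\<not> Q 0" using notM by (auto simp: Q_def)
  ultimately obtain r where r: "\<not> Q r" "Q (Suc r)"
    using ex_least_nat_less[of Q e] by blast
  let ?D = "{w \<in> P k. w [^] (p ^ r) \<in> M}"
  have "subgroup ?D G"
  proof (rule subgroupI)
    fix a b assume a: "a \<in> ?D" and b: "b \<in> ?D"
    then have ac: "a \<in> carrier G" and bc: "b \<in> carrier G" by auto
    have "(M #> a) \<otimes>\<^bsub>G Mod M\<^esub> (M #> b) = (M #> b) \<otimes>\<^bsub>G Mod M\<^esub> (M #> a)"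
      using a ac bc cen M.quotient_commutes_iff by blast
    then have "M #> (a \<otimes> b) [^] (p ^ r) = M #> a [^] (p ^ r) \<otimes> b [^] (p ^ r)"
      using ac bc Q.H.pow_mult_distrib[of "M #> a" "M #> b" "p ^ r"]
      by (simp only: Q.hom_mult Q.hom_nat_pow Q.hom_closed m_closed nat_pow_closed)
    moreover have "a [^] (p ^ r) \<otimes> b [^] (p ^ r) \<in> M" using a b by auto
    ultimately have "(a \<otimes> b) [^] (p ^ r) \<in> M"
      using M.quotient_eq_one_iff ac bc by (metis m_closed nat_pow_closed)
    then show "a \<otimes> b \<in> ?D" using a b by auto
  qed (auto simp: nat_pow_inv intro!: exI[of _ \<one>])
  moreover have "x [^] p \<in> ?D" if x: "x \<in> P k" for x
  proof -
    have "(x [^] p) [^] (p ^ r) \<in> M" using r(2) x by (simp add: Q_def nat_pow_pow)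
    then show ?thesis using x pow_in_power_chain power_chain_Suc_subset by blast
  qed
  ultimately have "P (Suc k) \<subseteq> ?D"
    using generate_subgroup_incl[of "(\<lambda>x. x [^] p) ` P k" ?D] by (auto simp: power_chain.simps(2))
  then show False using stable r(1) by (auto simp: Q_def)
qed

section \<open>The power chain reaches 1, and its elements have p-th roots\<close>

lemma power_chain_trivial:
  obtains n where "\<And>m. n \<le> m \<Longrightarrow> P m = {\<one>}"
proof -
  have "\<exists>k. P (Suc k) = P k"
  proof (rule ccontr)
    assume "\<nexists>k. P (Suc k) = P k"
    then have "P (Suc k) \<subset> P k" for k using power_chain_Suc_subset by blast
    moreover have "finite (P k)" for k
      using finite_carrier power_chain_carrier by (metis finite_subset subsetI)
    ultimately have less: "card (P (Suc k)) < card (P k)" for k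
      by (rule psubset_card_mono[rotated])
    have "card (P k) + k \<le> card (P 0)" for k
    proof (induction k)
      case (Suc k)
      then show ?case using less[of k] by linarith
    qed simp
    from this[of "Suc (card (P 0))"] show False by simp
  qed
  then obtain k where k: "P (Suc k) = P k" ..
  have "P m = {\<one>}" if "k \<le> m" for m
    using power_chain_antimono[OF that] power_chain_stable_imp_trivial[OF k]
      subgroup.one_closed[OF power_chain_subgroup, of m] by blast
  then show ?thesis by (rule that)
qed

text \<open>The commutator of \<open>w\<close> and \<open>x\<close> lies one step further down the
  chain than \<open>w\<close>, so its own commutators and its p-th power lie two steps further
  down.\<close>

lemma pow_mult_mod_power_chain:
  assumes x: "x \<in> carrier G" and w: "w \<in> P k"
  shows "P (Suc (Suc k)) #> (x \<otimes> w) [^] p = P (Suc (Suc k)) #> (x [^] p \<otimes> w [^] p)"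
proof (rule normal.odd_pow_mult_mod[OF power_chain_normal odd x _ refl])
  show wc: "w \<in> carrier G" using w power_chain_carrier by blast
  have d: "commutator G w x \<in> P (Suc k)" using commutator_in_power_chain[OF w x] .
  show "commutator G (commutator G w x) x \<in> P (Suc (Suc k))"
    "commutator G (commutator G w x) w \<in> P (Suc (Suc k))"
    "commutator G w x [^] p \<in> P (Suc (Suc k))"
    using commutator_in_power_chain[OF d] pow_in_power_chain[OF d] x wc by blast+
qed

lemma power_chain_root_mod:
  assumes "y \<in> P (Suc k)"
  shows "\<exists>w\<in>P k. P (Suc (Suc k)) #> y = P (Suc (Suc k)) #> w [^] p"
proof -
  interpret M: normal "P (Suc (Suc k))" G by (rule power_chain_normal)
  interpret K: normal "P k" G by (rule power_chain_normal)
  interpret Q: group_hom G "G Mod P (Suc (Suc k))" "\<lambda>x. P (Suc (Suc k)) #> x"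
    by (rule M.quotient_group_hom)
  have "y \<in> generate G ((\<lambda>x. x [^] p) ` P k)"
    using assms by (simp add: power_chain.simps(2))
  then show ?thesis
  proof (induction y rule: generate.induct)
    case one
    then show ?case by (intro bexI[of _ \<one>]) auto
  next
    case (incl h)
    then show ?case by auto
  next
    case (inv h)
    then obtain x where "x \<in> P k" "h = x [^] p" by auto
    then show ?case by (intro bexI[of _ "inv x"]) (auto simp: nat_pow_inv)
  next
    case (eng h1 h2)
    then obtain w1 w2 where w: "w1 \<in> P k" "w2 \<in> P k"
      and eq: "P (Suc (Suc k)) #> h1 = P (Suc (Suc k)) #> w1 [^] p"
        "P (Suc (Suc k)) #> h2 = P (Suc (Suc k)) #> w2 [^] p" by blast
    have c: "w1 \<in> carrier G" "w2 \<in> carrier G" using w by auto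
    have "(\<lambda>x. x [^] p) ` P k \<subseteq> carrier G" by auto
    then have hc: "h1 \<in> carrier G" "h2 \<in> carrier G"
      using eng generate_in_carrier by blast+
    have "P (Suc (Suc k)) #> (h1 \<otimes> h2) = P (Suc (Suc k)) #> (w1 [^] p \<otimes> w2 [^] p)"
      using eq hc c by (simp only: Q.hom_mult nat_pow_closed)
    also have "\<dots> = P (Suc (Suc k)) #> (w1 \<otimes> w2) [^] p"
      using pow_mult_mod_power_chain[OF c(1) w(2)] by simp
    finally show ?case using w by blast
  qed
qed

text \<open>Successive approximation, starting from the root 1 modulo \<open>P (Suc k)\<close>. If
  \<open>u\<close> is a root modulo \<open>P (Suc k + m)\<close>, the error z = u^(-p) y has an
  approximate root \<open>w\<close> in \<open>P (k + m)\<close>, and \<open>u \<otimes> w\<close> is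
  a root one step further down. The chain reaches 1, where the root is exact.\<close>

lemma power_chain_root:
  assumes y: "y \<in> P (Suc k)"
  obtains u where "u \<in> P k" "y = u [^] p"
proof -
  have yc: "y \<in> carrier G" using y power_chain_carrier by blast
  have "\<exists>u\<in>P k. P (Suc k + m) #> y = P (Suc k + m) #> u [^] p" for m
  proof (induction m)
    case 0
    have "P (Suc k) #> y = P (Suc k) #> \<one> [^] p"
      using coset_join2[OF yc power_chain_subgroup y] power_chain_carrier
      by (simp add: coset_mult_one subsetI)
    then show ?case using subgroup.one_closed[OF power_chain_subgroup[of k]]
      by (intro bexI[of _ \<one>]) simp_all
  next
    case (Suc m)
    then obtain u where u: "u \<in> P k" and eq: "P (Suc k + m) #> y = P (Suc k + m) #> u [^] p"
      by blast
    interpret M: normal "P (Suc k + m)" G by (rule power_chain_normal)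
    interpret QM: group_hom G "G Mod P (Suc k + m)" "\<lambda>x. P (Suc k + m) #> x"
      by (rule M.quotient_group_hom)
    interpret N: normal "P (Suc (Suc (k + m)))" G by (rule power_chain_normal)
    interpret QN: group_hom G "G Mod P (Suc (Suc (k + m)))" "\<lambda>x. P (Suc (Suc (k + m))) #> x"
      by (rule N.quotient_group_hom)
    have uc: "u \<in> carrier G" using u power_chain_carrier by blast
    define z where "z = inv (u [^] p) \<otimes> y"
    have zc: "z \<in> carrier G" and y_eq: "y = u [^] p \<otimes> z"
      using uc yc by (simp_all add: z_def inv_mult_cancel)
    have "P (Suc k + m) #> z = \<one>\<^bsub>G Mod P (Suc k + m)\<^esub>"
      using eq uc yc QM.H.l_inv[OF QM.hom_closed[of y]]
      by (simp only: z_def QM.hom_mult QM.hom_inv inv_closed nat_pow_closed)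
    then have "z \<in> P (Suc (k + m))" using M.quotient_eq_one_iff[OF zc] by simp
    then obtain w where w: "w \<in> P (k + m)"
      and zw: "P (Suc (Suc (k + m))) #> z = P (Suc (Suc (k + m))) #> w [^] p"
      using power_chain_root_mod by blast
    have wc: "w \<in> carrier G" and wk: "w \<in> P k"
      using w power_chain_carrier power_chain_antimono[of k "k + m"] by auto
    have "P (Suc (Suc (k + m))) #> y = P (Suc (Suc (k + m))) #> (u [^] p \<otimes> w [^] p)"
      using zw zc uc wc by (simp only: y_eq QN.hom_mult nat_pow_closed)
    also have "\<dots> = P (Suc (Suc (k + m))) #> (u \<otimes> w) [^] p"
      using pow_mult_mod_power_chain[OF uc w] by simp
    finally show ?case
      using subgroup.m_closed[OF power_chain_subgroup u wk] by (intro bexI[of _ "u \<otimes> w"]) simp_all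
  qed
  moreover obtain n where "P (Suc k + n) = {\<one>}"
    using power_chain_trivial by (metis le_add2)
  ultimately obtain u where u: "u \<in> P k" "{\<one>} #> y = {\<one>} #> u [^] p" by metis
  moreover have "u \<in> carrier G" using u power_chain_carrier by blast
  ultimately have "y = u [^] p" using yc by (simp add: r_coset_def)
  then show ?thesis using that u by blast
qed

lemma power_chain_eq_power_subgroup: "P k = power_subgroup G (p ^ k)"
proof
  have "\<exists>g\<in>carrier G. y = g [^] (p ^ k)" if "y \<in> P k" for y
    using that
  proof (induction k arbitrary: y)
    case (Suc k)
    then obtain u where "u \<in> P k" "y = u [^] p" using power_chain_root by blast
    moreover then obtain g where "g \<in> carrier G" "u = g [^] (p ^ k)" using Suc.IH by blast
    ultimately show ?case by (auto simp: nat_pow_pow mult.commute)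
  qed auto
  then show "P k \<subseteq> power_subgroup G (p ^ k)"
    unfolding power_subgroup_def by (auto intro!: generate.incl)
next
  have "g [^] (p ^ k) \<in> P k" if "g \<in> carrier G" for g
  proof (induction k)
    case (Suc k)
    then show ?case using pow_in_power_chain[OF Suc] that by (simp add: nat_pow_pow mult.commute)
  qed (use that in simp)
  then show "power_subgroup G (p ^ k) \<subseteq> P k"
    unfolding power_subgroup_def
    by (intro generate_subgroup_incl power_chain_subgroup) auto
qed

text \<open>If all commutators lie in \<open>P (Suc k)\<close>, then p-th powers are central modulo
  \<open>P (Suc (Suc k))\<close>. These are all elements of \<open>P 1\<close>, so modulo that term
  the group is generated by central elements and \<open>h\<close>, and all commutators lie one step
  further down. In the end they are trivial.\<close>

lemma commute_if_cyclic_mod_power_chain: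
  assumes h: "h \<in> carrier G" and gen: "generate G (insert h (P 1)) = carrier G"
    and x: "x \<in> carrier G" and y: "y \<in> carrier G"
  shows "x \<otimes> y = y \<otimes> x"
proof -
  have "\<forall>x\<in>carrier G. \<forall>y\<in>carrier G. commutator G x y \<in> P (Suc k)" for k
  proof (induction k)
    case 0
    then show ?case using commutator_in_power_chain[of _ 0] by simp
  next
    case (Suc k)
    interpret M: normal "P (Suc (Suc k))" G by (rule power_chain_normal)
    have pow: "commutator G (u [^] p) v \<in> P (Suc (Suc k))"
      if u: "u \<in> carrier G" and v: "v \<in> carrier G" for u v
    proof (rule M.odd_pow_commutator_mem[OF odd u v refl refl])
      have z: "commutator G u v \<in> P (Suc k)" using Suc u v by blast
      have d: "commutator G (commutator G u v) u \<in> P (Suc (Suc k))"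
        using commutator_in_power_chain[OF z u] .
      show "commutator G u v [^] p \<in> P (Suc (Suc k))" using pow_in_power_chain[OF z] .
      show "commutator G (commutator G u v) u [^] p \<in> P (Suc (Suc k))"
        using subgroup_nat_pow_closed[OF power_chain_subgroup d] .
    qed (use u v M.commutator_left_mem[OF commutator_in_power_chain] Suc in auto)
    have "commutator G a g \<in> P (Suc (Suc k))" if "a \<in> P 1" "g \<in> carrier G" for a g
    proof -
      have "a \<in> P (Suc 0)" using that by simp
      then obtain u where "u \<in> P 0" "a = u [^] p" by (rule power_chain_root)
      then show ?thesis using pow that by simp
    qed
    then have "commutator G x y \<in> P (Suc (Suc k))"
      if "x \<in> carrier G" "y \<in> carrier G" for x y
      using that gen h power_chain_carrier M.commutator_mem_of_generate_insert[of h "P 1" x y]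
      by blast
    then show ?case by blast
  qed
  moreover obtain n where "P (Suc n) = {\<one>}" using power_chain_trivial by (metis le_SucI order_refl)
  ultimately show ?thesis using x y commutator_eq_one_iff by blast
qed

section \<open>Elements of bounded order\<close>

lemma powerful_subgroup:
  assumes H: "subgroup H G"
    and comm: "\<And>x y. \<lbrakk>x \<in> H; y \<in> H\<rbrakk> \<Longrightarrow> commutator G x y \<in> generate G ((\<lambda>x. x [^] p) ` H)"
  shows "odd_powerful_group (G\<lparr>carrier := H\<rparr>) p"
proof -
  interpret H: group "G\<lparr>carrier := H\<rparr>" by (rule subgroup_imp_group[OF H])
  obtain n where "order G = p ^ n" by (rule order_eq_power)
  then have "card H dvd p ^ n" using lagrange[OF H] dvd_triv_right by metis
  then have "\<exists>m. card H = p ^ m" using divides_primepow_nat[OF prime] by blast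
  moreover have "finite H" using finite_carrier subgroup.subset[OF H] finite_subset by blast
  ultimately have fin: "finite_p_group p (G\<lparr>carrier := H\<rparr>)"
    by (simp add: finite_p_group_def prime H.is_group order_def)
  have "(\<lambda>x. x [^] p) ` H \<subseteq> carrier G" using subgroup.mem_carrier[OF H] by auto
  then have "derived G H \<subseteq> generate G ((\<lambda>x. x [^] p) ` H)"
    unfolding derived_def using comm
    by (intro generate_subgroup_incl generate_is_subgroup) (auto simp: commutator_def)
  then have "derived (G\<lparr>carrier := H\<rparr>) H \<subseteq> power_subgroup (G\<lparr>carrier := H\<rparr>) p"
    using derived_consistent[OF subset_refl H] power_subgroup_restrict[OF H] by simp
  then have "powerful p (G\<lparr>carrier := H\<rparr>)"
    using fin prime_gt_2 by (simp add: powerful_def)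
  then show ?thesis
    by (simp add: odd_powerful_group_def odd_powerful_group_axioms_def H.is_group prime odd)
qed

lemma torsion_normal:
  assumes "subgroup {x \<in> P k. x [^] (p ^ a) = \<one>} G"
  shows "{x \<in> P k. x [^] (p ^ a) = \<one>} \<lhd> G"
proof -
  interpret normal "P k" G by (rule power_chain_normal)
  show ?thesis using assms pow_conj inv_op_closed2 by (intro normal_invI) auto
qed

text \<open>
  Downward induction on \<open>b\<close> and, for fixed \<open>b\<close>, on \<open>c\<close>. Write \<open>x = u\<^sup>p\<close> and \<open>z = [u, h]\<close>. Case
  \<open>(b + 1, c - 1)\<close> bounds the order of \<open>z\<close>, and case \<open>(b, c + 1)\<close>, applied to \<open>[z, u]\<close>, shows that
  modulo \<open>{y \<in> P 1. y^(p^b) = 1}\<close> the group generated by \<open>u\<close> and \<open>z\<close> has class at most two, so that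
  \<open>[u\<^sup>p, h]\<close> is a product of \<open>p\<close>-th powers there.
\<close>

lemma commutator_order_drop_aux:
  assumes conj: "\<And>a u h. \<lbrakk>u \<in> carrier G; h \<in> carrier G; h [^] (p ^ a) = \<one>\<rbrakk>
      \<Longrightarrow> commutator G u h [^] (p ^ a) = \<one>"
    and sub: "\<And>a. subgroup {x \<in> P 1. x [^] (p ^ a) = \<one>} G"
    and x: "x \<in> P c" "x [^] (p ^ Suc b) = \<one>"
    and h: "h \<in> carrier G" "h [^] (p ^ (b + c)) = \<one>"
  shows "commutator G x h [^] (p ^ b) = \<one>"
proof -
  define Q where "Q b c \<longleftrightarrow> (\<forall>x\<in>P c. \<forall>h\<in>carrier G.
    x [^] (p ^ Suc b) = \<one> \<longrightarrow> h [^] (p ^ (b + c)) = \<one> \<longrightarrow> commutator G x h [^] (p ^ b) = \<one>)" for b c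
  have conj': "commutator G h u [^] (p ^ a) = \<one>"
    if "u \<in> carrier G" "h \<in> carrier G" "h [^] (p ^ a) = \<one>" for a u h
    using conj[OF that] that inv_commutator[of u h] by (metis commutator_closed inv_one nat_pow_inv)
  have pow_mono: "h [^] (p ^ m) = \<one>" if "h \<in> carrier G" "h [^] (p ^ k) = \<one>" "k \<le> m" for h k m
  proof -
    have "p ^ m = p ^ k * p ^ (m - k)" using that(3) by (simp flip: power_add)
    then show ?thesis using that by (simp flip: nat_pow_pow)
  qed
  obtain e where e: "\<And>x m. \<lbrakk>x \<in> carrier G; e \<le> m\<rbrakk> \<Longrightarrow> x [^] (p ^ m) = \<one>"
    by (rule exponent) blast
  obtain n where n: "\<And>m. n \<le> m \<Longrightarrow> P m = {\<one>}" by (rule power_chain_trivial) blast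
  \<comment> \<open>The boundary cases of the double induction: for large \<open>b\<close> the power
    p^b kills the whole group, for large \<open>c\<close> the element \<open>x\<close> is 1, and
    \<open>c = 0\<close> is the hypothesis \<open>conj\<close>.\<close>
  have Q_large_b: "Q b c" if "e \<le> b" for b c
    unfolding Q_def using e[OF _ that] power_chain_carrier by blast
  have Q_large_c: "Q b c" if "n \<le> c" for b c
    unfolding Q_def using n[OF that] by (simp add: commutator_def)
  have Q_zero: "Q b 0" for b
    unfolding Q_def using conj by simp
  have Q_step: "Q b (Suc c)" if IH1: "Q (Suc b) c" and IH2: "Q b (Suc (Suc c))" for b c
    unfolding Q_def
  proof (intro ballI impI)
    fix x h
    assume x: "x \<in> P (Suc c)" "x [^] (p ^ Suc b) = \<one>"
      and h: "h \<in> carrier G" "h [^] (p ^ (b + Suc c)) = \<one>"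
    let ?S = "{x \<in> P 1. x [^] (p ^ b) = \<one>}"
    interpret S: normal ?S G by (rule torsion_normal[OF sub])
    obtain u where u: "u \<in> P c" "x = u [^] p" using x(1) by (rule power_chain_root)
    have uc: "u \<in> carrier G" using u power_chain_carrier by blast
    have u_ord: "u [^] (p ^ Suc (Suc b)) = \<one>" using x(2) u(2) uc by (simp add: nat_pow_pow)
    define z where "z = commutator G u h"
    define d where "d = commutator G z u"
    have zP: "z \<in> P (Suc c)" unfolding z_def by (rule commutator_in_power_chain[OF u(1) h(1)])
    have dP: "d \<in> P (Suc (Suc c))" unfolding d_def by (rule commutator_in_power_chain[OF zP uc])
    have zc: "z \<in> carrier G" and dc: "d \<in> carrier G"
      using uc h(1) by (simp_all add: z_def d_def)
    \<comment> \<open>The bound on the order of \<open>h\<close> carries over unchanged, as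
      \<open>b + Suc c = Suc b + c\<close>.\<close>
    have z_ord: "z [^] (p ^ Suc b) = \<one>"
      using IH1 u(1) u_ord h unfolding Q_def z_def by (metis add_Suc add_Suc_right)
    have d_ord: "d [^] (p ^ Suc b) = \<one>"
      unfolding d_def by (rule conj'[OF uc zc z_ord])
    have in_S: "commutator G d g \<in> ?S" if g: "g \<in> carrier G" "g [^] (p ^ Suc (Suc b)) = \<one>" for g
    proof -
      have "g [^] (p ^ (b + Suc (Suc c))) = \<one>" by (rule pow_mono[OF g]) simp
      then have "commutator G d g [^] (p ^ b) = \<one>"
        using IH2 dP d_ord g(1) unfolding Q_def by blast
      moreover have "commutator G d g \<in> P 1"
        using commutator_in_power_chain[OF dP g(1)] power_chain_antimono[of 1] by auto
      ultimately show ?thesis by simp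
    qed
    have pow_S: "y [^] p \<in> ?S" if "y \<in> P (Suc m)" "y [^] (p ^ Suc b) = \<one>" for y m
    proof -
      have "y [^] p \<in> P (Suc (Suc m))" using pow_in_power_chain[OF that(1)] .
      then have "y [^] p \<in> P 1" using power_chain_antimono[of 1 "Suc (Suc m)"] by auto
      then show ?thesis using that power_chain_carrier[of y] by (simp add: nat_pow_pow)
    qed
    have "commutator G (u [^] p) h \<in> ?S"
    proof (rule S.odd_pow_commutator_mem[OF odd uc h(1) z_def d_def])
      show "commutator G d u \<in> ?S" using in_S[OF uc u_ord] .
      show "commutator G d z \<in> ?S" using in_S[OF zc pow_mono[OF zc z_ord]] by simp
      show "z [^] p \<in> ?S" using pow_S[OF zP z_ord] .
      show "d [^] p \<in> ?S" using pow_S[OF dP d_ord] .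
    qed
    then show "commutator G x h [^] (p ^ b) = \<one>" using u(2) by simp
  qed
  have Q_down: "\<forall>c. Q b c" if Suc_b: "\<forall>c. Q (Suc b) c" for b
  proof
    fix c
    show "Q b c"
    proof (cases "n \<le> c")
      case False
      then have "c \<le> n" by simp
      then show ?thesis
      proof (induction rule: inc_induct)
        case base
        show ?case by (rule Q_large_c) simp
      next
        case (step c)
        then show ?case using Q_zero Q_step Suc_b by (cases c) auto
      qed
    qed (rule Q_large_c)
  qed
  have "\<forall>c. Q b c"
  proof (cases "e \<le> b")
    case False
    then have "b \<le> e" by simp
    then show ?thesis
      by (induction rule: inc_induct) (simp_all add: Q_large_b Q_down)
  qed (simp add: Q_large_b)
  then show ?thesis using x h unfolding Q_def by blast
qed

end

text \<open>
  Induction on the order of \<open>G\<close>: unless \<open>G\<close> is abelian, \<open>P 1\<close> and the subgroups generated by \<open>P 1\<close>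
  and a single element \<open>h\<close> are proper and powerful. The latter contain the conjugates of \<open>h\<close>, which
  controls the order of \<open>[u, h]\<close>.
\<close>

lemma torsion_subgroup:
  fixes G (structure)
  assumes "odd_powerful_group G p"
  shows "subgroup {x \<in> carrier G. x [^] (p ^ a) = \<one>} G"
  using assms
proof (induction "order G" arbitrary: G a rule: less_induct)
  case (less G)
  interpret odd_powerful_group G p by fact
  have mem_torsion: "\<one>\<^bsub>G\<^esub> \<in> {x \<in> carrier G. x [^]\<^bsub>G\<^esub> (p ^ a) = \<one>\<^bsub>G\<^esub>}"
    "\<And>x. x \<in> {x \<in> carrier G. x [^]\<^bsub>G\<^esub> (p ^ a) = \<one>\<^bsub>G\<^esub>} \<Longrightarrow>
      inv\<^bsub>G\<^esub> x \<in> {x \<in> carrier G. x [^]\<^bsub>G\<^esub> (p ^ a) = \<one>\<^bsub>G\<^esub>}" for a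
    by (auto simp: nat_pow_inv)
  have reduce: ?case
    if "\<And>x y. \<lbrakk>x \<in> carrier G; y \<in> carrier G; x [^]\<^bsub>G\<^esub> (p ^ a) = \<one>\<^bsub>G\<^esub>; y [^]\<^bsub>G\<^esub> (p ^ a) = \<one>\<^bsub>G\<^esub>\<rbrakk>
      \<Longrightarrow> (x \<otimes>\<^bsub>G\<^esub> y) [^]\<^bsub>G\<^esub> (p ^ a) = \<one>\<^bsub>G\<^esub>"
    by (rule subgroupI) (use mem_torsion that in auto)
  show ?case
  proof (cases "\<forall>x\<in>carrier G. \<forall>y\<in>carrier G. x \<otimes>\<^bsub>G\<^esub> y = y \<otimes>\<^bsub>G\<^esub> x")
    case True
    then show ?thesis by (intro reduce) (simp add: pow_mult_distrib)
  next
    case noncomm: False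
    have IH: "subgroup {x \<in> H. x [^]\<^bsub>G\<^esub> (p ^ a) = \<one>\<^bsub>G\<^esub>} G"
      if H: "subgroup H G" "H \<noteq> carrier G" "odd_powerful_group (G\<lparr>carrier := H\<rparr>) p" for H a
    proof -
      have "H \<subset> carrier G" using H subgroup.subset by blast
      then have "order (G\<lparr>carrier := H\<rparr>) < order G"
        using psubset_card_mono[OF finite_carrier] by (simp add: order_def)
      from less.hyps[OF this H(3)] show ?thesis
        by (intro incl_subgroup[OF H(1)]) (simp add: nat_pow_consistent[symmetric])
    qed
    have P1: "subgroup {x \<in> P 1. x [^]\<^bsub>G\<^esub> (p ^ a) = \<one>\<^bsub>G\<^esub>} G" for a
    proof (rule IH[OF power_chain_subgroup])
      show "P 1 \<noteq> carrier G"
      proof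
        assume "P 1 = carrier G"
        then have "carrier G = {\<one>\<^bsub>G\<^esub>}" using power_chain_stable_imp_trivial[of 0] by simp
        then show False using noncomm by auto
      qed
      show "odd_powerful_group (G\<lparr>carrier := P 1\<rparr>) p"
      proof (rule powerful_subgroup[OF power_chain_subgroup])
        fix x y assume "x \<in> P 1" "y \<in> P 1"
        then have "commutator G x y \<in> P (Suc 1)"
          using commutator_in_power_chain power_chain_carrier by blast
        then show "commutator G x y \<in> generate G ((\<lambda>x. x [^]\<^bsub>G\<^esub> p) ` P 1)"
          by (simp only: power_chain.simps(2))
      qed
    qed
    have conj: "commutator G u h [^]\<^bsub>G\<^esub> (p ^ a) = \<one>\<^bsub>G\<^esub>"
      if u: "u \<in> carrier G" and h: "h \<in> carrier G" "h [^]\<^bsub>G\<^esub> (p ^ a) = \<one>\<^bsub>G\<^esub>" for a u h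
    proof -
      let ?H = "generate G (insert h (P 1))"
      have ins: "insert h (P 1) \<subseteq> carrier G" using h power_chain_carrier by blast
      have H: "subgroup ?H G" by (rule generate_is_subgroup[OF ins])
      have sub: "insert h (P 1) \<subseteq> ?H" by (rule subsetI) (rule generate.incl)
      have "?H \<noteq> carrier G" using commute_if_cyclic_mod_power_chain[OF h(1)] noncomm by blast
      moreover have "odd_powerful_group (G\<lparr>carrier := ?H\<rparr>) p"
      proof (rule powerful_subgroup[OF H])
        fix x y assume xy: "x \<in> ?H" "y \<in> ?H"
        have "commutator G x y \<in> P (Suc 1)"
          by (rule normal.commutator_mem_of_generate_insert[OF power_chain_normal h(1) _ _ xy])
            (use power_chain_carrier commutator_in_power_chain in auto)
        moreover have "P (Suc 1) \<subseteq> generate G ((\<lambda>x. x [^]\<^bsub>G\<^esub> p) ` ?H)"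
          unfolding power_chain.simps(2)[of _ _ 1] using sub by (intro mono_generate) auto
        ultimately show "commutator G x y \<in> generate G ((\<lambda>x. x [^]\<^bsub>G\<^esub> p) ` ?H)" by blast
      qed
      ultimately have T: "subgroup {x \<in> ?H. x [^]\<^bsub>G\<^esub> (p ^ a) = \<one>\<^bsub>G\<^esub>} G" (is "subgroup ?T G")
        using IH[OF H] by blast
      have hT: "h \<in> ?T" using h sub by simp
      have "commutator G u h \<in> P 1"
        using commutator_in_power_chain[of u 0] u h(1) by simp
      then have "u \<otimes>\<^bsub>G\<^esub> h \<otimes>\<^bsub>G\<^esub> inv\<^bsub>G\<^esub> u \<in> ?H"
        using conj_eq_commutator_mult[OF u h(1)] sub subgroup.m_closed[OF H] by auto
      then have "u \<otimes>\<^bsub>G\<^esub> h \<otimes>\<^bsub>G\<^esub> inv\<^bsub>G\<^esub> u \<in> ?T"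
        using pow_conj[OF u h(1)] h(2) u by simp
      then have "u \<otimes>\<^bsub>G\<^esub> h \<otimes>\<^bsub>G\<^esub> inv\<^bsub>G\<^esub> u \<otimes>\<^bsub>G\<^esub> inv\<^bsub>G\<^esub> h \<in> ?T"
        using subgroup.m_closed[OF T] subgroup.m_inv_closed[OF T hT] by blast
      then show ?thesis by (simp add: commutator_def)
    qed
    show ?thesis
    proof (rule reduce)
      fix x y
      assume x: "x \<in> carrier G" "x [^]\<^bsub>G\<^esub> (p ^ a) = \<one>\<^bsub>G\<^esub>"
        and y: "y \<in> carrier G" "y [^]\<^bsub>G\<^esub> (p ^ a) = \<one>\<^bsub>G\<^esub>"
      show "(x \<otimes>\<^bsub>G\<^esub> y) [^]\<^bsub>G\<^esub> (p ^ a) = \<one>\<^bsub>G\<^esub>"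
      proof (cases a)
        case 0
        then show ?thesis using x y by simp
      next
        case (Suc b)
        \<comment> \<open>By \<open>commutator_order_drop_aux\<close> with \<open>c = 1\<close>, the
          commutators of \<open>d\<close> with \<open>x\<close> and \<open>y\<close> lie in
          \<open>?S\<close>. Therefore (xy)^p agrees with x^p y^p modulo \<open>?S\<close>, and the
          latter product lies in \<open>?S\<close>.\<close>
        let ?S = "{x \<in> P 1. x [^]\<^bsub>G\<^esub> (p ^ b) = \<one>\<^bsub>G\<^esub>}"
        interpret S: normal ?S G by (rule torsion_normal[OF P1])
        define d where "d = commutator G y x"
        have dP: "d \<in> P 1" unfolding d_def using commutator_in_power_chain[of y 0] x y by simp
        have d_ord: "d [^]\<^bsub>G\<^esub> (p ^ Suc b) = \<one>\<^bsub>G\<^esub>"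
          unfolding d_def using conj[OF y(1) x] Suc by simp
        have dS: "commutator G d g \<in> ?S" if "g \<in> carrier G" "g [^]\<^bsub>G\<^esub> (p ^ a) = \<one>\<^bsub>G\<^esub>" for g
        proof -
          have "commutator G d g \<in> P 1"
            using normal.commutator_left_mem[OF power_chain_normal dP that(1)] .
          moreover have "g [^]\<^bsub>G\<^esub> (p ^ (b + 1)) = \<one>\<^bsub>G\<^esub>" using that(2) Suc by simp
          then have "commutator G d g [^]\<^bsub>G\<^esub> (p ^ b) = \<one>\<^bsub>G\<^esub>"
            using commutator_order_drop_aux[OF conj P1 dP d_ord that(1)] by blast
          ultimately show ?thesis by blast
        qed
        have pow_S: "g [^]\<^bsub>G\<^esub> p \<in> ?S" if "g \<in> carrier G" "g [^]\<^bsub>G\<^esub> (p ^ Suc b) = \<one>\<^bsub>G\<^esub>" for g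
          using that pow_in_power_chain[of g 0] by (simp add: nat_pow_pow)
        have "?S #>\<^bsub>G\<^esub> (x \<otimes>\<^bsub>G\<^esub> y) [^]\<^bsub>G\<^esub> p = ?S #>\<^bsub>G\<^esub> (x [^]\<^bsub>G\<^esub> p \<otimes>\<^bsub>G\<^esub> y [^]\<^bsub>G\<^esub> p)"
          by (rule S.odd_pow_mult_mod[OF odd x(1) y(1) d_def dS[OF x] dS[OF y]])
            (rule pow_S[OF power_chain_carrier[OF dP] d_ord])
        moreover have "x [^]\<^bsub>G\<^esub> p \<otimes>\<^bsub>G\<^esub> y [^]\<^bsub>G\<^esub> p \<in> ?S"
          using pow_S x y Suc by (intro S.m_closed) simp_all
        ultimately have "(x \<otimes>\<^bsub>G\<^esub> y) [^]\<^bsub>G\<^esub> p \<in> ?S"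
          using S.quotient_eq_one_iff[of "(x \<otimes>\<^bsub>G\<^esub> y) [^]\<^bsub>G\<^esub> p"]
            S.quotient_eq_one_iff[of "x [^]\<^bsub>G\<^esub> p \<otimes>\<^bsub>G\<^esub> y [^]\<^bsub>G\<^esub> p"] x(1) y(1)
          by (simp only: m_closed nat_pow_closed)
        then have "((x \<otimes>\<^bsub>G\<^esub> y) [^]\<^bsub>G\<^esub> p) [^]\<^bsub>G\<^esub> (p ^ b) = \<one>\<^bsub>G\<^esub>" by simp
        then show ?thesis using Suc x(1) y(1) by (simp add: nat_pow_pow)
      qed
    qed
  qed
qed

section \<open>Commutators of elements of bounded order\<close>

context odd_powerful_group
begin

abbreviation "torsion k a \<equiv> {x \<in> P k. x [^] (p ^ a) = \<one>}"

lemma torsion_is_normal: "torsion k a \<lhd> G"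
proof -
  have "torsion k a = P k \<inter> {x \<in> carrier G. x [^] (p ^ a) = \<one>}"
    using power_chain_carrier by blast
  then show ?thesis
    using subgroups_Inter_pair[OF power_chain_subgroup torsion_subgroup[OF odd_powerful_group_axioms]]
    by (intro torsion_normal) simp
qed

lemmas torsion_is_subgroup = normal_imp_subgroup[OF torsion_is_normal]

lemma commutator_order:
  assumes "u \<in> carrier G" "h \<in> carrier G" "h [^] (p ^ a) = \<one>"
  shows "commutator G u h [^] (p ^ a) = \<one>"
proof -
  have "h \<in> torsion 0 a" using assms by simp
  then have "commutator G h u \<in> torsion 0 a"
    by (rule normal.commutator_left_mem[OF torsion_is_normal _ assms(1)])
  then have "commutator G u h \<in> torsion 0 a"
    by (rule normal.commutator_swap_mem[OF torsion_is_normal assms(2,1), THEN iffD1])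
  then show ?thesis by simp
qed

text \<open>\<open>commutator_order_drop_aux\<close> carries two assumptions about torsion because
  it serves in the proof of \<open>torsion_subgroup\<close>; with that result at hand both hold in
  \<open>G\<close>.\<close>

lemma commutator_order_drop:
  assumes "x \<in> P c" "x [^] (p ^ Suc b) = \<one>" "h \<in> carrier G" "h [^] (p ^ (b + c)) = \<one>"
  shows "commutator G x h [^] (p ^ b) = \<one>"
  using commutator_order_drop_aux[OF commutator_order torsion_is_subgroup assms] .

text \<open>Write y = v^p. Modulo \<open>P (Suc (Suc c))\<close> both [[v, x], v] and the p-th power
  of [v, x] are trivial, so v^p and \<open>x\<close> commute there.\<close>

lemma commutator_in_power_chain_Suc_Suc:
  assumes x: "x \<in> P c" and y: "y \<in> P (Suc 0)"
  shows "commutator G x y \<in> P (Suc (Suc c))"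
proof -
  interpret M: normal "P (Suc (Suc c))" G by (rule power_chain_normal)
  obtain v where "v \<in> P 0" and yv: "y = v [^] p" using y by (rule power_chain_root)
  then have v: "v \<in> carrier G" by simp
  have xc: "x \<in> carrier G" using x power_chain_carrier by blast
  have z: "commutator G v x \<in> P (Suc c)"
    using normal.commutator_swap_mem[OF power_chain_normal v xc] commutator_in_power_chain[OF x v]
    by blast
  have d: "commutator G (commutator G v x) v \<in> P (Suc (Suc c))"
    by (rule commutator_in_power_chain[OF z v])
  have "commutator G (v [^] p) x \<in> P (Suc (Suc c))"
    by (rule M.odd_pow_commutator_mem[OF odd v xc refl refl])
      (intro M.commutator_left_mem pow_in_power_chain z d v xc commutator_closed
        subgroup_nat_pow_closed[OF power_chain_subgroup])+
  then show ?thesis using M.commutator_swap_mem[of y x] yv v xc by simp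
qed

text \<open>This serves the case \<open>k = i\<close> of the chain. Since \<open>x\<close> lies in
  \<open>P 1\<close>, the order drops by one factor \<open>p\<close>, and since \<open>y\<close>
  does, the commutator moves two steps down the chain.\<close>

lemma commutator_in_torsion_top:
  assumes x: "x \<in> torsion (Suc j) (Suc b)" and y: "y \<in> torsion (Suc j) (Suc b)"
  shows "commutator G x y \<in> torsion (Suc (Suc (Suc j))) b"
proof -
  have "P (Suc j) \<subseteq> P (Suc 0)" by (rule power_chain_antimono) simp
  then have x1: "x \<in> P (Suc 0)" and y1: "y \<in> P (Suc 0)" using x y by auto
  have "commutator G x y [^] (p ^ b) = \<one>"
    by (rule commutator_order_drop[OF x1]) (use x y power_chain_carrier in auto)
  then show ?thesis using commutator_in_power_chain_Suc_Suc[OF _ y1] x by simp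
qed

text \<open>Write y = v^p, so that \<open>v\<close> is killed by p^(b+m+2). This is exactly what
  \<open>commutator_order_drop\<close> requires twice: with \<open>c = Suc m\<close> it gives
  exponent p^(b+1) for z = [v, x], and with \<open>c = Suc (Suc m)\<close> exponent p^b for d =
  [z, v]. Then \<open>d\<close> and z^p lie in \<open>?M\<close>, and [v^p, x] follows.\<close>

lemma commutator_in_torsion_step:
  assumes x: "x \<in> torsion (Suc j + m) (Suc (Suc b))" and y: "y \<in> torsion (Suc j) (Suc b + m)"
  shows "commutator G x y \<in> torsion (Suc (Suc (Suc j + m))) b"
proof -
  let ?M = "torsion (Suc (Suc (Suc j + m))) b"
  interpret M: normal ?M G by (rule torsion_is_normal)
  have "y \<in> P (Suc j)" using y by simp
  then obtain v where "v \<in> P j" and yv: "y = v [^] p" by (rule power_chain_root)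
  then have v: "v \<in> carrier G" using power_chain_carrier by blast
  have v_ord: "v [^] (p ^ (Suc (Suc (b + m)))) = \<one>"
    using y yv v by (simp add: nat_pow_pow)
  have xP: "x \<in> P (Suc j + m)" using x by simp
  have xc: "x \<in> carrier G" using xP power_chain_carrier by blast
  define z where "z = commutator G v x"
  define d where "d = commutator G z v"
  have zP: "z \<in> P (Suc (Suc j + m))"
    unfolding z_def
    using normal.commutator_swap_mem[OF power_chain_normal v xc] commutator_in_power_chain[OF xP v]
    by blast
  have zc: "z \<in> carrier G" using zP power_chain_carrier by blast
  have "P (Suc j + m) \<subseteq> P (Suc m)" by (rule power_chain_antimono) simp
  then have "commutator G x v [^] (p ^ Suc b) = \<one>"
    using xP x v v_ord by (intro commutator_order_drop[of x "Suc m"]) auto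
  then have z_ord: "z [^] (p ^ Suc b) = \<one>"
    using inv_commutator[OF xc v] xc v unfolding z_def by (metis commutator_closed inv_one nat_pow_inv)
  have dP: "d \<in> P (Suc (Suc (Suc j + m)))"
    unfolding d_def by (rule commutator_in_power_chain[OF zP v])
  have "P (Suc (Suc j + m)) \<subseteq> P (Suc (Suc m))" by (rule power_chain_antimono) simp
  then have "d [^] (p ^ b) = \<one>"
    using zP z_ord v v_ord unfolding d_def by (intro commutator_order_drop[of z "Suc (Suc m)"]) auto
  then have dM: "d \<in> ?M" using dP by simp
  have zM: "z [^] p \<in> ?M"
    using pow_in_power_chain[OF zP] z_ord zc by (simp add: nat_pow_pow)
  have "commutator G (v [^] p) x \<in> ?M"
    by (rule M.odd_pow_commutator_mem[OF odd v xc z_def d_def])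
      (intro M.commutator_left_mem dM v zc zM subgroup_nat_pow_closed[OF M.is_subgroup])+
  then show ?thesis using M.commutator_swap_mem[of y x] yv v xc by blast
qed

section \<open>The powerfully central chain\<close>

lemma torsion_root:
  assumes "x \<in> torsion (Suc k) b"
  obtains v where "v \<in> torsion k (Suc b)" "x = v [^] p"
proof -
  have "x \<in> P (Suc k)" using assms by simp
  then obtain v where v: "v \<in> P k" "x = v [^] p" by (rule power_chain_root)
  moreover have "v [^] (p ^ Suc b) = \<one>"
    using assms v power_chain_carrier[of v] by (simp add: nat_pow_pow)
  ultimately show ?thesis using that by blast
qed

text \<open>
  The powerfully central chain of \<open>torsion j i\<close> is not the obvious one formed by its elements of order
  dividing \<open>p^k\<close>: that would force the elements of order dividing \<open>p\<^sup>2\<close> to be central, which fails in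
  general. Each step from the top goes one further into the power chain and, except for the first
  one, lowers the order.
\<close>

definition torsion_chain :: "nat \<Rightarrow> nat \<Rightarrow> nat \<Rightarrow> 'a set" where
  "torsion_chain j i k = (if k = 0 then {\<one>} else torsion (j + (i - k)) (min i (Suc k)))"

lemma torsion_chain_normal: "torsion_chain j i k \<lhd> G"
  unfolding torsion_chain_def using one_is_normal torsion_is_normal by simp

lemma commutator_torsion_chain:
  assumes j: "j \<ge> 1" and k: "1 \<le> k" "k \<le> i"
    and x: "x \<in> torsion_chain j i k" and y: "y \<in> torsion j i"
  shows "commutator G x y \<in> generate G ((\<lambda>x. x [^] p) ` torsion_chain j i (k - 1))"
proof -
  obtain j' where j': "j = Suc j'" using j by (cases j) auto
  obtain b where b: "k = Suc b" using k by (cases k) auto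
  obtain m where m: "i = k + m" using k le_Suc_ex by blast
  \<comment> \<open>With k = b + 1 and i = k + m, \<open>m = 0\<close> is the top term, where
    \<open>min i (Suc k)\<close> equals \<open>k\<close> and not k + 1.\<close>
  have comm: "commutator G x y \<in> torsion (Suc (Suc (j + m))) b"
  proof (cases m)
    case 0
    then show ?thesis
      using x y commutator_in_torsion_top[of x j' b y] by (simp add: torsion_chain_def j' b m)
  next
    case (Suc m')
    then show ?thesis
      using x y commutator_in_torsion_step[of x j' m b y] by (simp add: torsion_chain_def j' b m)
  qed
  \<comment> \<open>For \<open>b = 0\<close> the next lower term is 1, and p^0 leaves only the
    trivial commutator. For \<open>b > 0\<close> a p-th root of the commutator lies in
    \<open>torsion (Suc (j + m)) (Suc b)\<close>, which is exactly term k - 1.\<close>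
  show ?thesis
  proof (cases b)
    case 0
    then have "commutator G x y = \<one>" using comm power_chain_carrier[of "commutator G x y"] by auto
    then show ?thesis by (simp add: generate.one)
  next
    case (Suc b')
    obtain v where v: "v \<in> torsion (Suc (j + m)) (Suc b)" "commutator G x y = v [^] p"
      using comm by (rule torsion_root)
    then have "v \<in> torsion_chain j i (k - 1)"
      using Suc by (simp add: torsion_chain_def b m)
    then show ?thesis using v(2) by (auto intro: generate.incl)
  qed
qed

lemma torsion_chain_mono:
  assumes "1 \<le> k" "k \<le> i"
  shows "torsion_chain j i (k - 1) \<subseteq> torsion_chain j i k"
proof (cases "k = 1")
  case True
  then show ?thesis
    using subgroup.one_closed[OF normal_imp_subgroup[OF torsion_chain_normal], of j i k]
    by (simp add: torsion_chain_def[of j i 0])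
next
  case False
  have "P (j + (i - (k - 1))) \<subseteq> P (j + (i - k))" using assms by (intro power_chain_antimono) auto
  moreover have "x [^] (p ^ min i (Suc k)) = \<one>"
    if "x \<in> carrier G" "x [^] (p ^ min i k) = \<one>" for x
  proof -
    have "p ^ min i (Suc k) = p ^ min i k * p ^ (min i (Suc k) - min i k)"
      by (simp flip: power_add)
    then show ?thesis using that by (simp flip: nat_pow_pow)
  qed
  ultimately show ?thesis
    using False assms power_chain_carrier by (auto simp: torsion_chain_def)
qed

lemma torsion_chain_subset:
  assumes "k \<le> i"
  shows "torsion_chain j i k \<subseteq> torsion_chain j i i"
  using assms
proof (induction rule: inc_induct)
  case (step n)
  then show ?case using torsion_chain_mono[of "Suc n" i j] by auto
qed simp

lemma torsion_chain_top: "i \<ge> 1 \<Longrightarrow> torsion_chain j i i = torsion j i"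
  by (simp add: torsion_chain_def)

lemma powerfully_central_torsion_chain:
  assumes "i \<ge> 1" "j \<ge> 1"
  shows "powerfully_central_chain p (G\<lparr>carrier := torsion j i\<rparr>) i (torsion_chain j i)"
proof -
  let ?N = "torsion j i" and ?C = "torsion_chain j i"
  interpret N: group "G\<lparr>carrier := ?N\<rparr>" by (rule subgroup_imp_group[OF torsion_is_subgroup])
  have sub: "?C k \<subseteq> ?N" if "k \<le> i" for k
    using torsion_chain_subset[OF that, of j] torsion_chain_top[OF assms(1), of j] by simp
  have subN: "subgroup (?C k) (G\<lparr>carrier := ?N\<rparr>)" if "k \<le> i" for k
    by (rule subgroup_incl[OF normal_imp_subgroup[OF torsion_chain_normal] torsion_is_subgroup sub[OF that]])
  have comm: "commutator_subgroup (G\<lparr>carrier := ?N\<rparr>) (?C k) ?N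
      \<subseteq> power_subgroup (G\<lparr>carrier := ?C (k - 1)\<rparr>) p" if k: "k \<in> {1..i}" for k
  proof -
    \<comment> \<open>The estimates so far concern \<open>G\<close>, whereas the chain condition is
      about the group carried by \<open>?N\<close>; \<open>?K\<close> is the required power subgroup
      computed in \<open>G\<close>.\<close>
    let ?K = "generate G ((\<lambda>x. x [^] p) ` ?C (k - 1))"
    have C: "subgroup (?C (k - 1)) G" by (rule normal_imp_subgroup[OF torsion_chain_normal])
    have pow: "(\<lambda>x. x [^] p) ` ?C (k - 1) \<subseteq> ?C (k - 1)"
      using subgroup_nat_pow_closed[OF C] by auto
    have K: "subgroup ?K G"
      using pow subgroup.subset[OF C] by (intro generate_is_subgroup) blast
    have "?K \<subseteq> ?C (k - 1)" by (rule generate_subgroup_incl[OF pow C])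
    also have "\<dots> \<subseteq> ?N" using k by (intro sub) auto
    finally have KN: "subgroup ?K (G\<lparr>carrier := ?N\<rparr>)"
      by (rule subgroup_incl[OF K torsion_is_subgroup])
    have "h \<otimes> y \<otimes> inv\<^bsub>G\<lparr>carrier := ?N\<rparr>\<^esub> h \<otimes> inv\<^bsub>G\<lparr>carrier := ?N\<rparr>\<^esub> y \<in> ?K"
      if h: "h \<in> ?C k" and y: "y \<in> ?N" for h y
    proof -
      have "h \<in> ?N" using h k sub[of k] by auto
      then show ?thesis
        using commutator_torsion_chain[OF assms(2) _ _ h y] k y
        by (simp add: commutator_def m_inv_consistent[OF torsion_is_subgroup])
    qed
    then have "commutator_subgroup (G\<lparr>carrier := ?N\<rparr>) (?C k) ?N \<subseteq> ?K"
      unfolding commutator_subgroup_def by (intro N.generate_subgroup_incl[OF _ KN]) auto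
    then show ?thesis by (simp only: power_subgroup_restrict[OF C])
  qed
  show ?thesis
    unfolding powerfully_central_chain_def
    using subN comm torsion_chain_mono torsion_chain_top[OF assms(1), of j]
    by (simp add: torsion_chain_def[of j i 0])
qed

text \<open>This is the last step of the chain: the commutators lie in the p-th power subgroup of
  term i - 1, which is contained in that of the whole group.\<close>

lemma powerful_torsion:
  assumes "i \<ge> 1" "j \<ge> 1"
  shows "powerful p (G\<lparr>carrier := torsion j i\<rparr>)"
proof -
  have "commutator G x y \<in> generate G ((\<lambda>x. x [^] p) ` torsion j i)"
    if "x \<in> torsion j i" "y \<in> torsion j i" for x y
  proof -
    have "x \<in> torsion_chain j i i" using that(1) torsion_chain_top[OF assms(1)] by blast
    then have "commutator G x y \<in> generate G ((\<lambda>x. x [^] p) ` torsion_chain j i (i - 1))"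
      using commutator_torsion_chain[OF assms(2) assms(1) order_refl _ that(2)] by blast
    moreover have "torsion_chain j i (i - 1) \<subseteq> torsion j i"
      using torsion_chain_subset[of "i - 1" i j] torsion_chain_top[OF assms(1), of j] by simp
    ultimately show ?thesis by (rule subsetD[OF mono_generate[OF image_mono], rotated])
  qed
  then have "odd_powerful_group (G\<lparr>carrier := torsion j i\<rparr>) p"
    by (rule powerful_subgroup[OF torsion_is_subgroup])
  then show ?thesis by (rule odd_powerful_group.powerful)
qed

text \<open>The elements of order dividing p^i already form a subgroup, so generating adds
  nothing.\<close>

lemma Omega_power_chain: "Omega p i (G\<lparr>carrier := P j\<rparr>) = torsion j i"
proof -
  interpret K: group "G\<lparr>carrier := P j\<rparr>" by (rule subgroup_imp_group[OF power_chain_subgroup])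
  have "{x \<in> P j. K.ord x dvd p ^ i} = torsion j i"
    using K.pow_eq_id by (auto simp: nat_pow_consistent[symmetric])
  then have "Omega p i (G\<lparr>carrier := P j\<rparr>) = generate (G\<lparr>carrier := P j\<rparr>) (torsion j i)"
    unfolding Omega_def by simp
  also have "\<dots> = generate G (torsion j i)"
    by (rule generate_consistent[OF _ power_chain_subgroup]) auto
  also have "\<dots> = torsion j i"
    using generateI[OF torsion_is_subgroup subset_refl] by simp
  finally show ?thesis .
qed

end

theorem theorem11:
  fixes G :: "('a, 'b) monoid_scheme" and p i j :: nat
  assumes "Factorial_Ring.prime p" and "odd p"
    and "powerful p G"
    and "i \<ge> 1" and "j \<ge> 1"
  shows "powerfully_nilpotent p
           (G\<lparr>carrier := Omega p i (G\<lparr>carrier := power_subgroup G (p ^ j)\<rparr>)\<rparr>) \<and>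
         powerful_class p
           (G\<lparr>carrier := Omega p i (G\<lparr>carrier := power_subgroup G (p ^ j)\<rparr>)\<rparr>) \<le> i"
proof -
  have "group G" using assms(3) by (simp add: powerful_def finite_p_group_def)
  then interpret odd_powerful_group G p
    using assms by (simp add: odd_powerful_group_def odd_powerful_group_axioms_def)
  have "Omega p i (G\<lparr>carrier := power_subgroup G (p ^ j)\<rparr>) = torsion j i"
    using Omega_power_chain[of i j] power_chain_eq_power_subgroup[of j] by simp
  moreover have "powerful_class p (G\<lparr>carrier := torsion j i\<rparr>) \<le> i"
    unfolding powerful_class_def
    using powerfully_central_torsion_chain[OF assms(4,5)] by (intro Least_le) blast
  moreover have "powerfully_nilpotent p (G\<lparr>carrier := torsion j i\<rparr>)"
    unfolding powerfully_nilpotent_def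
    using powerfully_central_torsion_chain[OF assms(4,5)] powerful_torsion[OF assms(4,5)]
    by (intro conjI exI)
  ultimately show ?thesis by (simp only: simp_thms)
qed

end
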